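(* Let $n\ge 5$ be an integer and let $\alpha\in[0,1)$. Let $G$ be a graph in $\mathcal{G}_{n,n-4}$ having the maximum $A_\alpha$ spectral radius among all graphs in $\mathcal{G}_{n,n-4}$. Then $G\cong K_{n-4}^{c}\vee K_{4}$.
   Context: All graphs are simple and connected. For a graph $G$ with adjacency matrix $A(G)$ and diagonal degree matrix $D(G)$, and a real $\alpha\in[0,1]$, $A_\alpha(G)=\alpha D(G)+(1-\alpha)A(G)$; the $A_\alpha$ spectral radius $\lambda_\alpha(G)$ is the largest eigenvalue of $A_\alpha(G)$. The independence number of $G$ is the maximum size of a set of pairwise non-adjacent vertices. $\mathcal{G}_{n,i}$ denotes the set of (connected) graphs of order $n$ with independence number $i$. $K_{n-4}^c$ is the edgeless graph on $n-4$ vertices, $K_4$ the complete graph on 4 vertices, and $G_1\vee G_2$ is the join (disjoint union plus all edges between $V(G_1)$ and $V(G_2)$). *)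

theory Defs
  imports
    "Graph_Theory.Digraph_Component"
    "Graph_Theory.Digraph_Isomorphism"
    "Graph_Theory.Pair_Digraph"
    "Jordan_Normal_Form.Spectral_Radius"
begin

text \<open>
  Simple graphs are the symmetric loop-free finite digraphs of \<^locale>\<open>pair_graph\<close>: an edge
  \<open>uv\<close> is the pair of arcs \<open>(u, v)\<close>, \<open>(v, u)\<close>. In particular the degree of a vertex is its
  out-degree. \<open>Digraph_Component.connected\<close> requires at least one vertex.
\<close>

definition independent_set :: "'a pair_pre_digraph \<Rightarrow> 'a set \<Rightarrow> bool" where
  "independent_set G S \<longleftrightarrow> S \<subseteq> pverts G \<and> (\<forall>u\<in>S. \<forall>v\<in>S. (u, v) \<notin> parcs G)"

definition independence_number :: "'a pair_pre_digraph \<Rightarrow> nat" where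
  "independence_number G = Max (card ` {S. independent_set G S})"

text \<open>
  The class is taken within one vertex type. If it has a member of order \<open>n\<close>, the type has at
  least \<open>n\<close> elements, so every graph in the class occurs in it up to isomorphism.
\<close>

definition graph_class :: "nat \<Rightarrow> nat \<Rightarrow> 'a pair_pre_digraph set" where
  "graph_class n i =
    {G. pair_graph G \<and> Digraph_Component.connected (with_proj G) \<and>
        card (pverts G) = n \<and> independence_number G = i}"

text \<open>Matrices are indexed by the positions in a list \<open>vs\<close> enumerating the vertices.\<close>

definition adjacency_matrix :: "'a pair_pre_digraph \<Rightarrow> 'a list \<Rightarrow> real mat" where
  "adjacency_matrix G vs =
    mat (length vs) (length vs) (\<lambda>(i, j). if (vs ! i, vs ! j) \<in> parcs G then 1 else 0)"

definition degree_matrix :: "'a pair_pre_digraph \<Rightarrow> 'a list \<Rightarrow> real mat" where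
  "degree_matrix G vs =
    mat (length vs) (length vs)
      (\<lambda>(i, j). if i = j then real (out_degree (with_proj G) (vs ! i)) else 0)"

definition A_alpha :: "real \<Rightarrow> 'a pair_pre_digraph \<Rightarrow> 'a list \<Rightarrow> real mat" where
  "A_alpha \<alpha> G vs = \<alpha> \<cdot>\<^sub>m degree_matrix G vs + (1 - \<alpha>) \<cdot>\<^sub>m adjacency_matrix G vs"

definition enumerates :: "'a pair_pre_digraph \<Rightarrow> 'a list \<Rightarrow> bool" where
  "enumerates G vs \<longleftrightarrow> distinct vs \<and> set vs = pverts G"

text \<open>
  The choice of the enumeration is immaterial, see \<open>spectrum_A_alpha_enumeration\<close> below.
  As the matrix is real symmetric, its real spectrum consists of all of its eigenvalues.
\<close>

definition A_alpha_spectral_radius :: "real \<Rightarrow> 'a pair_pre_digraph \<Rightarrow> real" where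
  "A_alpha_spectral_radius \<alpha> G = Max (spectrum (A_alpha \<alpha> G (SOME vs. enumerates G vs)))"

definition edgeless_graph :: "nat \<Rightarrow> nat pair_pre_digraph" where
  "edgeless_graph m = \<lparr> pverts = {..<m}, parcs = {} \<rparr>"

definition complete_graph :: "nat \<Rightarrow> nat pair_pre_digraph" where
  "complete_graph m = \<lparr> pverts = {..<m}, parcs = {(u, v). u < m \<and> v < m \<and> u \<noteq> v} \<rparr>"

definition graph_join ::
  "'a pair_pre_digraph \<Rightarrow> 'b pair_pre_digraph \<Rightarrow> ('a + 'b) pair_pre_digraph" (infixl "\<nabla>" 65) where
  "G \<nabla> H =
    \<lparr> pverts = pverts G <+> pverts H,
      parcs = map_prod Inl Inl ` parcs G \<union> map_prod Inr Inr ` parcs H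
        \<union> Inl ` pverts G \<times> Inr ` pverts H \<union> Inr ` pverts H \<times> Inl ` pverts G \<rparr>"

definition A_alpha_entry :: "real \<Rightarrow> 'a pair_pre_digraph \<Rightarrow> 'a \<Rightarrow> 'a \<Rightarrow> real" where
  "A_alpha_entry \<alpha> G u v =
    \<alpha> * (if u = v then real (out_degree (with_proj G) u) else 0)
    + (1 - \<alpha>) * (if (u, v) \<in> parcs G then 1 else 0)"

lemma A_alpha_dim [simp]:
  "dim_row (A_alpha \<alpha> G vs) = length vs" "dim_col (A_alpha \<alpha> G vs) = length vs"
  by (simp_all add: A_alpha_def adjacency_matrix_def)

lemma A_alpha_index:
  assumes "distinct vs" "i < length vs" "j < length vs"
  shows "A_alpha \<alpha> G vs $$ (i, j) = A_alpha_entry \<alpha> G (vs ! i) (vs ! j)"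
  using assms
  by (simp add: A_alpha_def adjacency_matrix_def degree_matrix_def A_alpha_entry_def
      nth_eq_iff_index_eq)

lemma A_alpha_mult_index:
  assumes vs: "enumerates G vs" and i: "i < length vs" and x: "x \<in> carrier_vec (length vs)"
    and f: "\<And>j. j < length vs \<Longrightarrow> f (vs ! j) = x $ j"
  shows "(A_alpha \<alpha> G vs *\<^sub>v x) $ i = (\<Sum>w\<in>pverts G. A_alpha_entry \<alpha> G (vs ! i) w * f w)"
proof -
  have d: "distinct vs" and s: "set vs = pverts G" using vs by (auto simp: enumerates_def)
  have "(A_alpha \<alpha> G vs *\<^sub>v x) $ i = (\<Sum>j = 0..<length vs. A_alpha \<alpha> G vs $$ (i, j) * x $ j)"
    using i x by (simp add: scalar_prod_def)
  also have "\<dots> = (\<Sum>j\<in>{..<length vs}. A_alpha_entry \<alpha> G (vs ! i) (vs ! j) * f (vs ! j))"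
    by (rule sum.cong) (auto simp: A_alpha_index[OF d i] f)
  also have "\<dots> = (\<Sum>w\<in>pverts G. A_alpha_entry \<alpha> G (vs ! i) w * f w)"
    by (rule sum.reindex_bij_betw) (rule bij_betw_nth[OF d refl s[symmetric]])
  finally show ?thesis .
qed

lemma eigenvalue_A_alpha_iff:
  assumes vs: "enumerates G vs"
  shows "eigenvalue (A_alpha \<alpha> G vs) k \<longleftrightarrow>
    (\<exists>f. (\<exists>v\<in>pverts G. f v \<noteq> 0) \<and>
      (\<forall>v\<in>pverts G. (\<Sum>w\<in>pverts G. A_alpha_entry \<alpha> G v w * f w) = k * f v))"
    (is "?L \<longleftrightarrow> ?R")
proof
  have d: "distinct vs" and s: "set vs = pverts G" using vs by (auto simp: enumerates_def)
  {
    assume ?L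
    then obtain x where x: "x \<in> carrier_vec (length vs)" "x \<noteq> 0\<^sub>v (length vs)"
      and e: "A_alpha \<alpha> G vs *\<^sub>v x = k \<cdot>\<^sub>v x"
      by (auto simp: eigenvalue_def eigenvector_def)
    define f where "f v = x $ (THE i. i < length vs \<and> vs ! i = v)" for v
    have f: "f (vs ! j) = x $ j" if "j < length vs" for j
    proof -
      have "(THE i. i < length vs \<and> vs ! i = vs ! j) = j"
        using d that by (auto simp: nth_eq_iff_index_eq)
      then show ?thesis by (simp add: f_def)
    qed
    obtain j where "j < length vs" "x $ j \<noteq> 0"
      using x by (metis carrier_vecD eq_vecI index_zero_vec(1) index_zero_vec(2))
    then have "vs ! j \<in> pverts G" "f (vs ! j) \<noteq> 0" using f s by auto
    moreover have "(\<Sum>w\<in>pverts G. A_alpha_entry \<alpha> G v w * f w) = k * f v" if v: "v \<in> pverts G" for v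
    proof -
      obtain i where i: "i < length vs" "v = vs ! i"
        using v unfolding s[symmetric] in_set_conv_nth by blast
      have "(\<Sum>w\<in>pverts G. A_alpha_entry \<alpha> G v w * f w) = (A_alpha \<alpha> G vs *\<^sub>v x) $ i"
        unfolding i(2) by (rule A_alpha_mult_index[OF vs i(1) x(1) f, symmetric])
      also have "\<dots> = k * f v"
        unfolding e i(2) f[OF i(1)] using i(1) x(1) by (simp only: carrier_vecD index_smult_vec(1))
      finally show ?thesis .
    qed
    ultimately show ?R by blast
  }
  {
    assume ?R
    then obtain f v where v: "v \<in> pverts G" "f v \<noteq> 0"
      and e: "\<And>v. v \<in> pverts G \<Longrightarrow> (\<Sum>w\<in>pverts G. A_alpha_entry \<alpha> G v w * f w) = k * f v"
      by blast
    define x where "x = vec (length vs) (\<lambda>i. f (vs ! i))"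
    have x: "x \<in> carrier_vec (length vs)" by (simp add: x_def)
    have f: "f (vs ! j) = x $ j" if "j < length vs" for j
      using that by (simp add: x_def)
    obtain i where i: "i < length vs" "v = vs ! i"
      using v(1) unfolding s[symmetric] in_set_conv_nth by blast
    have "x \<noteq> 0\<^sub>v (length vs)"
      using f[OF i(1)] i v by auto
    moreover have "A_alpha \<alpha> G vs *\<^sub>v x = k \<cdot>\<^sub>v x"
    proof (rule eq_vecI)
      fix i assume "i < dim_vec (k \<cdot>\<^sub>v x)"
      then have i: "i < length vs" using x by simp
      have "(A_alpha \<alpha> G vs *\<^sub>v x) $ i = k * f (vs ! i)"
        by (rule trans[OF A_alpha_mult_index[OF vs i x f] e]) (use nth_mem[OF i] s in simp_all)
      also have "\<dots> = (k \<cdot>\<^sub>v x) $ i"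
        unfolding f[OF i] using i x by (simp only: carrier_vecD index_smult_vec(1))
      finally show "(A_alpha \<alpha> G vs *\<^sub>v x) $ i = (k \<cdot>\<^sub>v x) $ i" .
    qed (simp add: carrier_vecD[OF x])
    ultimately show ?L
      unfolding eigenvalue_def eigenvector_def A_alpha_dim using x by blast
  }
qed

lemma spectrum_A_alpha_enumeration:
  assumes "enumerates G vs" "enumerates G ws"
  shows "spectrum (A_alpha \<alpha> G vs) = spectrum (A_alpha \<alpha> G ws)"
  using assms by (auto simp: spectrum_def eigenvalue_A_alpha_iff)

lemma A_alpha_spectral_radius_eq:
  assumes "enumerates G vs"
  shows "A_alpha_spectral_radius \<alpha> G = Max (spectrum (A_alpha \<alpha> G vs))"
  unfolding A_alpha_spectral_radius_def
  using spectrum_A_alpha_enumeration[OF someI[of "enumerates G", OF assms] assms] by simp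

end

theory Submission
  imports Defs "HOL-Analysis.Function_Topology"
begin

text \<open>
  Let \<open>S\<close> be a maximum independent set of \<open>G\<close>. Adding to \<open>G\<close> all missing edges not inside \<open>S\<close>
  gives a graph \<open>K\<^sub>n\<^sub>-\<^sub>4\<^sup>c \<or> K\<^sub>4\<close> of the same class, so it suffices that adding an edge to a connected
  graph strictly increases the spectral radius. The quadratic form of the \<open>A\<^sub>\<alpha>\<close>-matrix is the sum
  over the arcs \<open>uw\<close> of \<open>\<alpha> f(u)\<^sup>2 + (1 - \<alpha>) f(u) f(w)\<close>, hence replacing a maximizer \<open>f\<close> of the Rayleigh
  quotient by \<open>|f|\<close> gives a maximizer again. The latter is an eigenvector, and by connectedness it has
  no zero entry; then every new arc strictly increases its Rayleigh quotient.
\<close>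

section \<open>Quadratic forms and their Rayleigh quotients on a finite set\<close>

definition quad_form :: "'a set \<Rightarrow> ('a \<Rightarrow> 'a \<Rightarrow> real) \<Rightarrow> ('a \<Rightarrow> real) \<Rightarrow> real" where
  "quad_form V M f = (\<Sum>u\<in>V. \<Sum>w\<in>V. M u w * f u * f w)"

lemma quad_form_cong:
  "(\<And>v. v \<in> V \<Longrightarrow> f v = g v) \<Longrightarrow> quad_form V M f = quad_form V M g"
  unfolding quad_form_def by (intro sum.cong) auto

lemma quad_form_scale: "quad_form V M (\<lambda>v. c * f v) = c\<^sup>2 * quad_form V M f"
  by (simp add: quad_form_def sum_distrib_left power2_eq_square algebra_simps)

text \<open>Symmetry of \<open>M\<close> merges the two cross terms. The coefficient of
  \<open>t\<close> is the first variation of the form at \<open>f\<close> in the direction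
  \<open>h\<close>.\<close>

lemma quad_form_add:
  assumes "\<And>u w. u \<in> V \<Longrightarrow> w \<in> V \<Longrightarrow> M u w = M w u"
  shows "quad_form V M (\<lambda>v. f v + t * h v) =
    quad_form V M f + 2 * t * (\<Sum>u\<in>V. h u * (\<Sum>w\<in>V. M u w * f w)) + t\<^sup>2 * quad_form V M h"
proof -
  have s: "(\<Sum>u\<in>V. \<Sum>w\<in>V. M u w * f u * h w) = (\<Sum>u\<in>V. \<Sum>w\<in>V. M u w * h u * f w)"
    by (subst sum.swap) (intro sum.cong refl, simp add: assms)
  have "quad_form V M (\<lambda>v. f v + t * h v) = quad_form V M f
      + t * (\<Sum>u\<in>V. \<Sum>w\<in>V. M u w * h u * f w)
      + t * (\<Sum>u\<in>V. \<Sum>w\<in>V. M u w * f u * h w) + t\<^sup>2 * quad_form V M h"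
    unfolding quad_form_def sum_distrib_left sum.distrib[symmetric]
    by (intro sum.cong refl) (simp add: power2_eq_square algebra_simps)
  also have "(\<Sum>u\<in>V. \<Sum>w\<in>V. M u w * h u * f w) = (\<Sum>u\<in>V. h u * (\<Sum>w\<in>V. M u w * f w))"
    by (simp add: sum_distrib_left algebra_simps)
  finally show ?thesis unfolding s
    by (simp add: sum_distrib_left algebra_simps)
qed

lemma quad_form_eigenvector:
  assumes "\<And>v. v \<in> V \<Longrightarrow> (\<Sum>w\<in>V. M v w * f w) = k * f v"
  shows "quad_form V M f = k * (\<Sum>v\<in>V. (f v)\<^sup>2)"
proof -
  have "quad_form V M f = (\<Sum>u\<in>V. f u * (\<Sum>w\<in>V. M u w * f w))"
    by (simp add: quad_form_def sum_distrib_left algebra_simps)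
  also have "\<dots> = (\<Sum>u\<in>V. k * (f u)\<^sup>2)"
    by (intro sum.cong refl) (simp add: assms power2_eq_square)
  finally show ?thesis by (simp add: sum_distrib_left)
qed

text \<open>Near 0 a nonzero linear term outgrows any quadratic one.\<close>

lemma linear_le_square_imp_zero:
  fixes a b :: real
  assumes "\<And>t. a * t \<le> b * t\<^sup>2"
  shows "a = 0"
proof (rule ccontr)
  assume a: "a \<noteq> 0"
  define c where "c = \<bar>b\<bar> + 1"
  have c: "c > 0" "b < c" by (auto simp: c_def)
  \<comment> \<open>The test value is \<open>t = a / c\<close>; clearing denominators leaves
    \<open>c * a\<^sup>2\<close> bounded by \<open>b * a\<^sup>2\<close>, although
    \<open>b < c\<close>.\<close>
  have "a * (a / c) * c\<^sup>2 \<le> b * (a / c)\<^sup>2 * c\<^sup>2"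
    by (rule mult_right_mono[OF assms]) simp
  then have "c * a\<^sup>2 \<le> b * a\<^sup>2"
    using c by (simp add: power2_eq_square field_simps)
  with a c(2) show False by simp
qed

text \<open>The gap between the two sides of \<open>le\<close> is nonnegative and vanishes at
  \<open>f\<close>, so its derivative at \<open>f\<close> is zero in every direction. The coordinate
  direction of \<open>v\<close> gives row \<open>v\<close> of the eigenvalue equation.\<close>

lemma rayleigh_maximizer_eigenvector:
  assumes fin: "finite V" and sym: "\<And>u w. u \<in> V \<Longrightarrow> w \<in> V \<Longrightarrow> M u w = M w u"
    and le: "\<And>g. quad_form V M g \<le> k * (\<Sum>v\<in>V. (g v)\<^sup>2)"
    and eq: "quad_form V M f = k * (\<Sum>v\<in>V. (f v)\<^sup>2)"
    and v: "v \<in> V"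
  shows "(\<Sum>w\<in>V. M v w * f w) = k * f v"
proof -
  define h :: "'a \<Rightarrow> real" where "h u = (if u = v then 1 else 0)" for u
  define m where "m = (\<Sum>w\<in>V. M v w * f w)"
  have m: "(\<Sum>u\<in>V. h u * (\<Sum>w\<in>V. M u w * f w)) = m"
    using fin v by (simp add: h_def m_def if_distrib[of "\<lambda>x. x * _"] sum.delta cong: if_cong)
  \<comment> \<open>Evaluate \<open>le\<close> at \<open>f + t h\<close>, with \<open>h\<close> the
    unit vector at \<open>v\<close>. The constant terms cancel by \<open>eq\<close>, leaving a
    linear term bounded by a quadratic one for \<open>t\<close> of either sign.\<close>
  have "2 * (m - k * f v) * t \<le> (k - quad_form V M h) * t\<^sup>2" for t
  proof -
    have "(\<Sum>u\<in>V. (f u + t * h u)\<^sup>2) =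
        (\<Sum>u\<in>V. (f u)\<^sup>2 + (if u = v then 2 * t * f v + t\<^sup>2 else 0))"
      by (intro sum.cong refl) (auto simp: h_def power2_eq_square algebra_simps)
    also have "\<dots> = (\<Sum>u\<in>V. (f u)\<^sup>2) + 2 * t * f v + t\<^sup>2"
      using fin v by (simp add: sum.distrib)
    finally have n: "(\<Sum>u\<in>V. (f u + t * h u)\<^sup>2) = (\<Sum>u\<in>V. (f u)\<^sup>2) + 2 * t * f v + t\<^sup>2" .
    have q: "quad_form V M (\<lambda>u. f u + t * h u) = quad_form V M f + 2 * t * m + t\<^sup>2 * quad_form V M h"
      unfolding m[symmetric] by (rule quad_form_add) (rule sym)
    have "k * (\<Sum>v\<in>V. (f v)\<^sup>2) + 2 * t * m + t\<^sup>2 * quad_form V M h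
        \<le> k * ((\<Sum>v\<in>V. (f v)\<^sup>2) + 2 * t * f v + t\<^sup>2)"
      using le[of "\<lambda>u. f u + t * h u"] unfolding q n eq .
    then show ?thesis by (simp add: algebra_simps)
  qed
  then have "2 * (m - k * f v) = 0" by (rule linear_le_square_imp_zero)
  then show ?thesis by (simp add: m_def)
qed

text \<open>The type \<open>'a\<close> may be infinite, so functions are pinned to 0 outside
  \<open>V\<close>. The sphere is then a closed subset of a product of compact sets, and Tychonoff
  applies.\<close>

lemma compact_unit_sphere:
  assumes "finite V"
  shows "compact {f :: 'a \<Rightarrow> real. (\<Sum>v\<in>V. (f v)\<^sup>2) = 1 \<and> (\<forall>v. v \<notin> V \<longrightarrow> f v = 0)}" (is "compact ?S")
proof -
  define C :: "('a \<Rightarrow> real) set" where "C = PiE UNIV (\<lambda>v. if v \<in> V then {-1..1} else {0})"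
  have "compactin (product_topology (\<lambda>_. euclidean) UNIV) C"
    unfolding C_def compactin_PiE by auto
  then have "compact C" by (simp add: euclidean_product_topology)
  moreover have "closed {f :: 'a \<Rightarrow> real. (\<Sum>v\<in>V. (f v)\<^sup>2) = 1}"
    by (intro closed_Collect_eq continuous_intros continuous_on_product_coordinates)
  moreover have "?S = C \<inter> {f. (\<Sum>v\<in>V. (f v)\<^sup>2) = 1}"
  proof -
    \<comment> \<open>Each single square is at most the whole sum, so the sphere lies in the box
      \<open>C\<close>.\<close>
    have "\<bar>f v\<bar> \<le> 1" if "(\<Sum>v\<in>V. (f v)\<^sup>2) = 1" "v \<in> V" for f :: "'a \<Rightarrow> real" and v
      using member_le_sum[OF that(2), of "\<lambda>v. (f v)\<^sup>2"] assms that(1) by (simp add: abs_square_le_1)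
    then show ?thesis by (fastforce simp: C_def PiE_def Pi_def abs_le_iff split: if_splits)
  qed
  ultimately show ?thesis by (simp only: compact_Int_closed)
qed

text \<open>\<open>k\<close> is the maximum of the form on the compact unit sphere; homogeneity of
  degree 2 carries the bound to all functions.\<close>

lemma rayleigh_maximizer_exists:
  assumes fin: "finite V" and ne: "V \<noteq> {}"
  shows "\<exists>f k. (\<exists>v\<in>V. f v \<noteq> 0) \<and> quad_form V M f = k * (\<Sum>v\<in>V. (f v)\<^sup>2) \<and>
    (\<forall>g. quad_form V M g \<le> k * (\<Sum>v\<in>V. (g v)\<^sup>2))"
proof -
  define S where "S = {f :: 'a \<Rightarrow> real. (\<Sum>v\<in>V. (f v)\<^sup>2) = 1 \<and> (\<forall>v. v \<notin> V \<longrightarrow> f v = 0)}"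
  have "compact S" unfolding S_def by (rule compact_unit_sphere[OF fin])
  moreover obtain a where a: "a \<in> V" using ne by blast
  have "(\<Sum>v\<in>V. (if v = a then 1 else 0 :: real)\<^sup>2) = (\<Sum>v\<in>V. if v = a then 1 else 0)"
    by (intro sum.cong) auto
  then have "(\<lambda>v. if v = a then 1 else 0) \<in> S" using a fin by (auto simp: S_def)
  then have "S \<noteq> {}" by blast
  moreover have "continuous_on S (quad_form V M)"
    unfolding quad_form_def
    by (intro continuous_intros continuous_on_subset[OF continuous_on_product_coordinates]) auto
  ultimately obtain f where f: "f \<in> S" and max: "\<And>g. g \<in> S \<Longrightarrow> quad_form V M g \<le> quad_form V M f"
    using continuous_attains_sup by metis
  have 1: "(\<Sum>v\<in>V. (f v)\<^sup>2) = 1" using f by (simp add: S_def)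
  have "quad_form V M g \<le> quad_form V M f * (\<Sum>v\<in>V. (g v)\<^sup>2)" for g
  proof (cases "\<forall>v\<in>V. g v = 0")
    case True
    then show ?thesis by (simp add: quad_form_def)
  next
    case False
    define r where "r = (\<Sum>v\<in>V. (g v)\<^sup>2)"
    have r: "r > 0" using False fin unfolding r_def
      by (metis (mono_tags, lifting) sum_pos2 zero_le_power2 zero_less_power2)
    \<comment> \<open>Scaling \<open>g\<close> to norm 1 and cutting it off outside \<open>V\<close>
      gives a member of \<open>S\<close>; the form only sees values on \<open>V\<close>.\<close>
    define c where "c = 1 / sqrt r"
    have c: "c\<^sup>2 = 1 / r" using r by (simp add: c_def power_divide)
    define h where "h v = (if v \<in> V then c * g v else 0)" for v
    have "(\<Sum>v\<in>V. (h v)\<^sup>2) = c\<^sup>2 * r"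
      by (simp add: h_def r_def sum_distrib_left power_mult_distrib)
    then have "h \<in> S" using c r by (simp add: S_def h_def)
    moreover have "quad_form V M h = c\<^sup>2 * quad_form V M g"
      unfolding quad_form_scale[symmetric] by (rule quad_form_cong) (simp add: h_def)
    ultimately have "quad_form V M g / r \<le> quad_form V M f" using max[of h] c by simp
    then show ?thesis using r by (simp add: r_def[symmetric] pos_divide_le_eq)
  qed
  moreover have "\<exists>v\<in>V. f v \<noteq> 0"
  proof (rule ccontr)
    assume "\<not> ?thesis"
    then have "(\<Sum>v\<in>V. (f v)\<^sup>2) = 0" by simp
    with 1 show False by simp
  qed
  ultimately show ?thesis
    using 1 by (intro exI[of _ f] exI[of _ "quad_form V M f"]) simp
qed

section \<open>The quadratic form of the \<open>A_alpha\<close> matrix and its largest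
  eigenvalue\<close>

lemma A_alpha_entry_sym:
  assumes "pair_graph G"
  shows "A_alpha_entry \<alpha> G u w = A_alpha_entry \<alpha> G w u"
proof -
  interpret pair_graph G by fact
  show ?thesis by (auto simp: A_alpha_entry_def dest: arcs_symmetric)
qed

lemma out_degree_eq_sum:
  assumes "pair_graph G"
  shows "real (out_degree (with_proj G) u) = (\<Sum>w\<in>pverts G. if (u, w) \<in> parcs G then 1 else 0)"
proof -
  interpret pair_graph G by fact
  have "out_arcs (with_proj G) u = Pair u ` {w \<in> pverts G. (u, w) \<in> parcs G}"
    by (auto simp: out_arcs_def dest: in_arcsD2)
  then have "out_degree (with_proj G) u = card {w \<in> pverts G. (u, w) \<in> parcs G}"
    by (simp add: out_degree_def card_image inj_on_def)
  then show ?thesis using pair_finite_verts by (simp add: sum.If_cases Int_def)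
qed

text \<open>The degree in the diagonal entry at \<open>u\<close> counts the arcs leaving
  \<open>u\<close>, so each of these arcs receives one copy of
  \<open>\<alpha> * (f u)\<^sup>2\<close>.\<close>

lemma quad_form_A_alpha:
  assumes "pair_graph G"
  shows "quad_form (pverts G) (A_alpha_entry \<alpha> G) f =
    (\<Sum>u\<in>pverts G. \<Sum>w\<in>pverts G.
      if (u, w) \<in> parcs G then \<alpha> * (f u)\<^sup>2 + (1 - \<alpha>) * (f u * f w) else 0)"
  unfolding quad_form_def
proof (rule sum.cong[OF refl])
  interpret pair_graph G by fact
  fix u assume u: "u \<in> pverts G"
  let ?d = "real (out_degree (with_proj G) u)"
  have "(\<Sum>w\<in>pverts G. A_alpha_entry \<alpha> G u w * f u * f w) =
      (\<Sum>w\<in>pverts G. (if u = w then \<alpha> * (f u)\<^sup>2 * ?d else 0)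
        + (if (u, w) \<in> parcs G then (1 - \<alpha>) * (f u * f w) else 0))"
    by (intro sum.cong refl) (auto simp: A_alpha_entry_def power2_eq_square algebra_simps)
  also have "\<dots> = \<alpha> * (f u)\<^sup>2 * ?d
      + (\<Sum>w\<in>pverts G. if (u, w) \<in> parcs G then (1 - \<alpha>) * (f u * f w) else 0)"
    using u pair_finite_verts by (simp add: sum.distrib)
  also have "\<dots> = (\<Sum>w\<in>pverts G.
      if (u, w) \<in> parcs G then \<alpha> * (f u)\<^sup>2 + (1 - \<alpha>) * (f u * f w) else 0)"
    unfolding out_degree_eq_sum[OF assms] sum_distrib_left sum.distrib[symmetric]
    by (intro sum.cong) auto
  finally show "(\<Sum>w\<in>pverts G. A_alpha_entry \<alpha> G u w * f u * f w) = \<dots>" .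
qed

text \<open>The maximal Rayleigh quotient \<open>k\<close> is an eigenvalue, since a maximizer is an
  eigenvector. Every eigenvalue is the Rayleigh quotient of its own eigenvector, hence at most
  \<open>k\<close>. So \<open>k\<close> is the maximum of the finite spectrum.\<close>

lemma A_alpha_spectral_radius_rayleigh:
  assumes G: "pair_graph G" and ne: "pverts G \<noteq> {}"
  shows A_alpha_spectral_radius_ge:
      "quad_form (pverts G) (A_alpha_entry \<alpha> G) g
        \<le> A_alpha_spectral_radius \<alpha> G * (\<Sum>v\<in>pverts G. (g v)\<^sup>2)"
    and A_alpha_spectral_radius_attained:
      "\<exists>f. (\<exists>v\<in>pverts G. f v \<noteq> 0) \<and> quad_form (pverts G) (A_alpha_entry \<alpha> G) f
        = A_alpha_spectral_radius \<alpha> G * (\<Sum>v\<in>pverts G. (f v)\<^sup>2)"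
proof -
  interpret pair_graph G by fact
  let ?V = "pverts G" and ?M = "A_alpha_entry \<alpha> G"
  obtain f k where f: "\<exists>v\<in>?V. f v \<noteq> 0" "quad_form ?V ?M f = k * (\<Sum>v\<in>?V. (f v)\<^sup>2)"
    and le: "\<And>g. quad_form ?V ?M g \<le> k * (\<Sum>v\<in>?V. (g v)\<^sup>2)"
    using rayleigh_maximizer_exists[OF pair_finite_verts ne, of ?M] by blast
  obtain vs where vs: "enumerates G vs"
    using finite_distinct_list[OF pair_finite_verts] unfolding enumerates_def by blast
  have "\<forall>v\<in>?V. (\<Sum>w\<in>?V. ?M v w * f w) = k * f v"
    by (intro ballI rayleigh_maximizer_eigenvector[OF pair_finite_verts A_alpha_entry_sym[OF G] le f(2)])
  then have k: "k \<in> spectrum (A_alpha \<alpha> G vs)"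
    using f(1) unfolding spectrum_def mem_Collect_eq eigenvalue_A_alpha_iff[OF vs] by blast
  have "l \<le> k" if l: "l \<in> spectrum (A_alpha \<alpha> G vs)" for l
  proof -
    obtain h where h: "\<exists>v\<in>?V. h v \<noteq> 0"
      and e: "\<forall>v\<in>?V. (\<Sum>w\<in>?V. ?M v w * h w) = l * h v"
      using l unfolding spectrum_def mem_Collect_eq eigenvalue_A_alpha_iff[OF vs] by blast
    have "l * (\<Sum>v\<in>?V. (h v)\<^sup>2) \<le> k * (\<Sum>v\<in>?V. (h v)\<^sup>2)"
      using le[of h] quad_form_eigenvector[of ?V ?M h l] e by simp
    moreover have "(\<Sum>v\<in>?V. (h v)\<^sup>2) > 0"
      using h pair_finite_verts by (metis (mono_tags, lifting) sum_pos2 zero_le_power2 zero_less_power2)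
    ultimately show ?thesis by simp
  qed
  moreover have "A_alpha \<alpha> G vs \<in> carrier_mat (length vs) (length vs)"
    by (rule carrier_matI) simp_all
  then have "finite (spectrum (A_alpha \<alpha> G vs))" by (rule card_finite_spectrum(1))
  ultimately have "A_alpha_spectral_radius \<alpha> G = k"
    unfolding A_alpha_spectral_radius_eq[OF vs] using k by (intro Max_eqI) auto
  then show "quad_form ?V ?M g \<le> A_alpha_spectral_radius \<alpha> G * (\<Sum>v\<in>?V. (g v)\<^sup>2)"
    and "\<exists>f. (\<exists>v\<in>?V. f v \<noteq> 0) \<and> quad_form ?V ?M f = A_alpha_spectral_radius \<alpha> G * (\<Sum>v\<in>?V. (f v)\<^sup>2)"
    using le f by auto
qed

section \<open>Positive maximizers and strict monotonicity under adding edges\<close>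

lemma A_alpha_perron_vector:
  assumes G: "pair_graph G" and con: "Digraph_Component.connected (with_proj G)"
    and \<alpha>: "0 \<le> \<alpha>" "\<alpha> < 1"
  obtains f where "\<And>v. v \<in> pverts G \<Longrightarrow> f v > 0"
    "quad_form (pverts G) (A_alpha_entry \<alpha> G) f
      = A_alpha_spectral_radius \<alpha> G * (\<Sum>v\<in>pverts G. (f v)\<^sup>2)"
proof -
  interpret pair_graph G by fact
  let ?V = "pverts G" and ?M = "A_alpha_entry \<alpha> G" and ?k = "A_alpha_spectral_radius \<alpha> G"
  have sc: "strongly_connected (with_proj G)"
    using symmetric_connected_imp_strongly_connected[OF pair_sym_arcs con] .
  then have ne: "?V \<noteq> {}" by (simp add: strongly_connected_def)
  obtain f where f: "\<exists>v\<in>?V. f v \<noteq> 0" "quad_form ?V ?M f = ?k * (\<Sum>v\<in>?V. (f v)\<^sup>2)"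
    using A_alpha_spectral_radius_attained[OF G ne] by blast
  define h where "h v = \<bar>f v\<bar>" for v
  have h0: "h v \<ge> 0" for v by (simp add: h_def)
  \<comment> \<open>Arc by arc: the squares are unchanged and each product is at most its absolute
    value, weighted by \<open>1 - \<alpha>\<close>.\<close>
  have "quad_form ?V ?M f \<le> quad_form ?V ?M h"
    unfolding quad_form_A_alpha[OF G]
  proof (intro sum_mono)
    fix u w
    have "(1 - \<alpha>) * (f u * f w) \<le> (1 - \<alpha>) * (h u * h w)"
      unfolding h_def abs_mult[symmetric] using \<alpha> by (intro mult_left_mono) auto
    then show "(if (u, w) \<in> parcs G then \<alpha> * (f u)\<^sup>2 + (1 - \<alpha>) * (f u * f w) else 0)
      \<le> (if (u, w) \<in> parcs G then \<alpha> * (h u)\<^sup>2 + (1 - \<alpha>) * (h u * h w) else 0)"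
      by (simp add: h_def)
  qed
  moreover have "(\<Sum>v\<in>?V. (h v)\<^sup>2) = (\<Sum>v\<in>?V. (f v)\<^sup>2)" by (simp add: h_def)
  \<comment> \<open>\<open>h\<close> has the norm of \<open>f\<close> and at least its form value,
    which is already maximal, so equality holds.\<close>
  ultimately have h: "quad_form ?V ?M h = ?k * (\<Sum>v\<in>?V. (h v)\<^sup>2)"
    using f(2) A_alpha_spectral_radius_ge[OF G ne, of \<alpha> h] by simp
  have e: "(\<Sum>w\<in>?V. ?M v w * h w) = ?k * h v" if "v \<in> ?V" for v
    using rayleigh_maximizer_eigenvector[OF pair_finite_verts A_alpha_entry_sym[OF G]
        A_alpha_spectral_radius_ge[OF G ne] h that] .
  \<comment> \<open>At a zero of \<open>h\<close> the eigenvalue equation is a vanishing sum of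
    nonnegative terms. The entry on an arc is \<open>1 - \<alpha> > 0\<close>, so the zero passes to
    each neighbour.\<close>
  have step: "h w = 0" if "(v, w) \<in> parcs G" "h v = 0" for v w
  proof -
    have vw: "v \<in> ?V" "w \<in> ?V" using wellformed'[OF that(1)] by auto
    have "(\<Sum>w\<in>?V. ?M v w * h w) = 0" using e[OF vw(1)] that(2) by simp
    moreover have "\<forall>w\<in>?V. 0 \<le> ?M v w * h w" using \<alpha> h0 by (auto simp: A_alpha_entry_def)
    ultimately have "?M v w * h w = 0"
      using sum_nonneg_eq_0_iff[OF pair_finite_verts, of "\<lambda>w. ?M v w * h w"] vw by blast
    moreover have "?M v w > 0"
      using that(1) \<alpha> by (auto simp: A_alpha_entry_def dest: no_loops')
    ultimately show ?thesis by simp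
  qed
  have "h v > 0" if v: "v \<in> ?V" for v
  proof (rule ccontr)
    assume "\<not> h v > 0"
    then have hv: "h v = 0" using h0[of v] by simp
    obtain u where u: "u \<in> ?V" "f u \<noteq> 0" using f(1) by blast
    \<comment> \<open>A path carries the zero from \<open>v\<close> to \<open>u\<close>, where
      \<open>f\<close> is nonzero.\<close>
    have "v \<rightarrow>\<^sup>*\<^bsub>with_proj G\<^esub> u" using sc v u(1) by (auto simp: strongly_connected_def)
    then have "h u = 0"
      by (induction rule: reachable_induct) (auto intro: hv step)
    with u(2) show False by (simp add: h_def)
  qed
  then show thesis using h that by blast
qed

text \<open>The positive maximizer for \<open>G\<close> serves as a test vector for
  \<open>H\<close>: both forms add up the same positive arc terms, but \<open>H\<close> has more
  arcs.\<close>

lemma A_alpha_spectral_radius_strict_mono: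
  assumes G: "pair_graph G" and con: "Digraph_Component.connected (with_proj G)"
    and H: "pair_graph H" and V: "pverts H = pverts G" and E: "parcs G \<subset> parcs H"
    and \<alpha>: "0 \<le> \<alpha>" "\<alpha> < 1"
  shows "A_alpha_spectral_radius \<alpha> G < A_alpha_spectral_radius \<alpha> H"
proof -
  interpret G: pair_graph G by fact
  interpret H: pair_graph H by fact
  let ?V = "pverts G"
  obtain f where pos: "\<And>v. v \<in> ?V \<Longrightarrow> f v > 0"
    and f: "quad_form ?V (A_alpha_entry \<alpha> G) f = A_alpha_spectral_radius \<alpha> G * (\<Sum>v\<in>?V. (f v)\<^sup>2)"
    using A_alpha_perron_vector[OF G con \<alpha>] by metis
  obtain a b where ab: "(a, b) \<in> parcs H" "(a, b) \<notin> parcs G" using E by auto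
  have abV: "a \<in> ?V" "b \<in> ?V" using H.wellformed'[OF ab(1)] V by auto
  let ?t = "\<lambda>u w. \<alpha> * (f u)\<^sup>2 + (1 - \<alpha>) * (f u * f w)"
  have t: "?t u w > 0" if "u \<in> ?V" "w \<in> ?V" for u w
    using \<alpha> pos[OF that(1)] pos[OF that(2)] by (intro add_nonneg_pos) auto
  let ?g = "\<lambda>u w. if (u, w) \<in> parcs G then ?t u w else 0"
  let ?h = "\<lambda>u w. if (u, w) \<in> parcs H then ?t u w else 0"
  have le: "?g u w \<le> ?h u w" if "u \<in> ?V" "w \<in> ?V" for u w
    using E t[OF that] by auto
  \<comment> \<open>The new arc \<open>(a, b)\<close> makes row \<open>a\<close> strictly larger; no
    other row decreases.\<close>
  have "(\<Sum>w\<in>?V. ?g a w) < (\<Sum>w\<in>?V. ?h a w)"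
    using t[OF abV] ab abV le
    by (intro sum_strict_mono_ex1[OF G.pair_finite_verts]) (auto intro!: bexI[of _ b])
  then have "(\<Sum>u\<in>?V. \<Sum>w\<in>?V. ?g u w) < (\<Sum>u\<in>?V. \<Sum>w\<in>?V. ?h u w)"
    using abV le by (intro sum_strict_mono_ex1[OF G.pair_finite_verts] ballI sum_mono) blast+
  then have "quad_form ?V (A_alpha_entry \<alpha> G) f < quad_form ?V (A_alpha_entry \<alpha> H) f"
    using quad_form_A_alpha[OF G, of \<alpha> f] quad_form_A_alpha[OF H, of \<alpha> f] V by simp
  also have "\<dots> \<le> A_alpha_spectral_radius \<alpha> H * (\<Sum>v\<in>?V. (f v)\<^sup>2)"
    using A_alpha_spectral_radius_ge[OF H, of \<alpha> f] V abV by auto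
  finally have "A_alpha_spectral_radius \<alpha> G * (\<Sum>v\<in>?V. (f v)\<^sup>2)
    < A_alpha_spectral_radius \<alpha> H * (\<Sum>v\<in>?V. (f v)\<^sup>2)" unfolding f .
  then show ?thesis by (rule mult_right_less_imp_less) (simp add: sum_nonneg)
qed

section \<open>Complete split graphs, their independence number and their form as a join\<close>

text \<open>For disjoint \<open>S\<close> and \<open>T\<close> this is the join of an edgeless and a
  complete graph, built inside the type \<open>'a\<close> so that it can be compared with
  \<open>G\<close> arc by arc and within the same class.\<close>

definition complete_split_graph :: "'a set \<Rightarrow> 'a set \<Rightarrow> 'a pair_pre_digraph" where
  "complete_split_graph S T =
    \<lparr> pverts = S \<union> T,
      parcs = {(u, v). u \<in> S \<union> T \<and> v \<in> S \<union> T \<and> u \<noteq> v \<and> \<not> (u \<in> S \<and> v \<in> S)} \<rparr>"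

lemma pair_graph_complete_split_graph:
  assumes "finite S" "finite T"
  shows "pair_graph (complete_split_graph S T)"
proof -
  have "finite (parcs (complete_split_graph S T))"
    by (rule finite_subset[of _ "(S \<union> T) \<times> (S \<union> T)"]) (use assms in \<open>auto simp: complete_split_graph_def\<close>)
  then show ?thesis
    using assms by unfold_locales (auto simp: complete_split_graph_def symmetric_def intro!: symI)
qed

text \<open>A vertex outside \<open>S\<close> is adjacent to all others, so an independent set not
  contained in \<open>S\<close> is a singleton, which the nonempty \<open>S\<close> matches in
  size.\<close>

lemma independence_number_complete_split_graph:
  assumes "finite S" "finite T" "S \<inter> T = {}" "S \<noteq> {}"
  shows "independence_number (complete_split_graph S T) = card S"
  unfolding independence_number_def
proof (rule Max_eqI)
  let ?H = "complete_split_graph S T"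
  have "{U. independent_set ?H U} \<subseteq> Pow (S \<union> T)"
    by (auto simp: independent_set_def complete_split_graph_def)
  then show "finite (card ` {U. independent_set ?H U})"
    using assms by (meson finite_Pow_iff finite_UnI finite_imageI finite_subset)
  have "independent_set ?H S" by (auto simp: independent_set_def complete_split_graph_def)
  then show "card S \<in> card ` {U. independent_set ?H U}" by blast
  fix m assume "m \<in> card ` {U. independent_set ?H U}"
  then obtain U where U: "independent_set ?H U" "m = card U" by blast
  show "m \<le> card S"
  proof (cases "U \<subseteq> S")
    case True
    then show ?thesis using U(2) assms(1) by (simp add: card_mono)
  next
    case False
    then obtain v where v: "v \<in> U" "v \<in> T" "v \<notin> S"
      using U(1) by (auto simp: independent_set_def complete_split_graph_def)
    have "U \<subseteq> {v}"
      using U(1) v by (fastforce simp: independent_set_def complete_split_graph_def)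
    then have "m \<le> 1" unfolding U(2) by (metis card_mono card.empty card_insert_disjoint finite.emptyI
          finite.insertI One_nat_def empty_iff)
    also have "1 \<le> card S" using assms by (simp add: Suc_le_eq card_gt_0_iff)
    finally show ?thesis .
  qed
qed

text \<open>Numberings of \<open>S\<close> and \<open>T\<close> are glued into one map
  \<open>h\<close> to the sum type.\<close>

lemma digraph_iso_complete_split_graph_join:
  assumes fin: "finite S" "finite T" and dis: "S \<inter> T = {}"
  shows "digraph_iso (with_proj (complete_split_graph S T))
    (with_proj (edgeless_graph (card S) \<nabla> complete_graph (card T)))"
proof -
  let ?H = "complete_split_graph S T"
  interpret pair_graph ?H by (rule pair_graph_complete_split_graph[OF fin])
  obtain f where f: "bij_betw f S {..<card S}"
    using ex_bij_betw_finite_nat[OF fin(1)] by (auto simp: atLeast0LessThan)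
  obtain g where g: "bij_betw g T {..<card T}"
    using ex_bij_betw_finite_nat[OF fin(2)] by (auto simp: atLeast0LessThan)
  define h :: "'a \<Rightarrow> nat + nat" where "h v = (if v \<in> S then Inl (f v) else Inr (g v))" for v
  have hS: "h v = Inl (f v)" if "v \<in> S" for v using that by (simp add: h_def)
  have hT: "h v = Inr (g v)" if "v \<in> T" for v using that dis by (auto simp: h_def)
  have inj: "inj_on h (S \<union> T)"
    using f g dis by (auto simp: inj_on_def h_def bij_betw_def split: if_splits)
  have fS: "f ` S = {..<card S}" and gT: "g ` T = {..<card T}"
    using f g by (auto simp: bij_betw_def)
  have "h ` S = Inl ` f ` S" "h ` T = Inr ` g ` T"
    using hS hT by (auto simp: image_image)
  then have hST: "h ` S = Inl ` {..<card S}" "h ` T = Inr ` {..<card T}"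
    by (simp_all add: fS gT)
  \<comment> \<open>The arcs are cut into the blocks of the join; the block inside \<open>S\<close>
    is empty.\<close>
  have arcs: "parcs ?H = {(u, v). u \<in> T \<and> v \<in> T \<and> u \<noteq> v} \<union> S \<times> T \<union> T \<times> S"
    using dis by (auto simp: complete_split_graph_def)
  have TT: "map_prod h h ` {(u, v). u \<in> T \<and> v \<in> T \<and> u \<noteq> v}
      = map_prod Inr Inr ` {(i, j). i < card T \<and> j < card T \<and> i \<noteq> j}" (is "?L = ?R")
  proof -
    have "{(i, j). i < card T \<and> j < card T \<and> i \<noteq> j}
        = map_prod g g ` {(u, v). u \<in> T \<and> v \<in> T \<and> u \<noteq> v}"
    proof (intro equalityI subsetI)
      fix p assume "p \<in> {(i, j). i < card T \<and> j < card T \<and> i \<noteq> j}"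
      then obtain i j where p: "p = (i, j)" "i \<in> g ` T" "j \<in> g ` T" "i \<noteq> j"
        unfolding gT by auto
      then show "p \<in> map_prod g g ` {(u, v). u \<in> T \<and> v \<in> T \<and> u \<noteq> v}" by force
    next
      fix p assume "p \<in> map_prod g g ` {(u, v). u \<in> T \<and> v \<in> T \<and> u \<noteq> v}"
      then show "p \<in> {(i, j). i < card T \<and> j < card T \<and> i \<noteq> j}"
        using g by (auto simp: bij_betw_def inj_on_def)
    qed
    then have "?R = map_prod (Inr \<circ> g) (Inr \<circ> g) ` {(u, v). u \<in> T \<and> v \<in> T \<and> u \<noteq> v}"
      by (simp add: image_comp map_prod.comp)
    also have "\<dots> = ?L" by (rule image_cong[OF refl]) (auto simp: hT)
    finally show ?thesis by simp
  qed
  \<comment> \<open>Arcs are vertex pairs, so \<open>h\<close> acts on both components, and tail and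
    head remain the projections.\<close>
  define hom where "hom = \<lparr> iso_verts = h, iso_arcs = map_prod h h,
    iso_head = snd, iso_tail = fst :: _ \<Rightarrow> nat + nat \<rparr>"
  have "inj_on (map_prod h h) (parcs ?H)"
    by (rule inj_on_subset[OF map_prod_inj_on[OF inj inj]]) (auto simp: complete_split_graph_def)
  then have "digraph_isomorphism hom"
    using inj wf_digraph_axioms unfolding digraph_isomorphism_def
    by (auto simp: hom_def complete_split_graph_def)
  moreover have "with_proj (edgeless_graph (card S) \<nabla> complete_graph (card T)) = app_iso hom (with_proj ?H)"
  proof -
    have "map_prod h h ` parcs ?H = map_prod Inr Inr ` {(i, j). i < card T \<and> j < card T \<and> i \<noteq> j}
      \<union> Inl ` {..<card S} \<times> Inr ` {..<card T} \<union> Inr ` {..<card T} \<times> Inl ` {..<card S}"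
      unfolding arcs image_Un TT map_prod_surj_on[OF refl refl] hST ..
    moreover have "h ` pverts ?H = Inl ` {..<card S} \<union> Inr ` {..<card T}"
      by (simp add: complete_split_graph_def image_Un hST)
    ultimately show ?thesis
      by (simp add: with_proj_def app_iso_def hom_def graph_join_def edgeless_graph_def
          complete_graph_def Plus_def)
  qed
  ultimately show ?thesis unfolding digraph_iso_def by blast
qed

section \<open>Saturating an extremal graph outside a maximum independent set\<close>

theorem theorem3p2:
  fixes n :: nat and \<alpha> :: real and G :: "'a pair_pre_digraph"
  assumes "n \<ge> 5"
    and "0 \<le> \<alpha>" and "\<alpha> < 1"
    and "G \<in> graph_class n (n - 4)"
    and "\<And>H :: 'a pair_pre_digraph. H \<in> graph_class n (n - 4) \<Longrightarrow>
           A_alpha_spectral_radius \<alpha> H \<le> A_alpha_spectral_radius \<alpha> G"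
  shows "digraph_iso (with_proj G) (with_proj (edgeless_graph (n - 4) \<nabla> complete_graph 4))"
proof -
  have G: "pair_graph G" and con: "Digraph_Component.connected (with_proj G)"
    and n: "card (pverts G) = n" and i: "independence_number G = n - 4"
    using assms(4) by (auto simp: graph_class_def)
  interpret pair_graph G by (rule G)
  \<comment> \<open>Finiteness, together with the empty set as a member, ensures that the
    \<open>Max\<close> is attained by some \<open>S\<close>.\<close>
  have "finite {S. independent_set G S}"
    by (rule finite_subset[of _ "Pow (pverts G)"]) (auto simp: independent_set_def pair_finite_verts)
  moreover have "independent_set G {}" by (simp add: independent_set_def)
  ultimately have "independence_number G \<in> card ` {S. independent_set G S}"
    unfolding independence_number_def by (intro Max_in) auto
  then obtain S where S: "independent_set G S" "card S = n - 4" using i by auto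
  define T where "T = pverts G - S"
  have SV: "S \<subseteq> pverts G" using S(1) by (simp add: independent_set_def)
  have fin: "finite S" "finite T"
    using SV pair_finite_verts by (auto simp: T_def intro: finite_subset)
  have dis: "S \<inter> T = {}" and un: "S \<union> T = pverts G" using SV by (auto simp: T_def)
  have T: "card T = 4"
    using card_Diff_subset[OF fin(1) SV] n S(2) assms(1) by (simp add: T_def)
  \<comment> \<open>Here \<open>n \<ge> 5\<close> makes \<open>n - 4\<close> positive.\<close>
  have "S \<noteq> {}" using S(2) assms(1) by auto
  let ?H = "complete_split_graph S T"
  have H: "pair_graph ?H" by (rule pair_graph_complete_split_graph[OF fin])
  interpret H: pair_graph ?H by (rule H)
  have V: "pverts ?H = pverts G" by (simp add: complete_split_graph_def un)
  \<comment> \<open>\<open>G\<close> is loop-free and has no arc inside \<open>S\<close>;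
    \<open>?H\<close> contains every other arc.\<close>
  have E: "parcs G \<subseteq> parcs ?H"
    using S(1) unfolding complete_split_graph_def independent_set_def un
    by (auto dest: wellformed' no_loops')
  have "spanning (with_proj G) (with_proj ?H)"
    unfolding spanning_def subgraph_def using V E
    by (auto simp: wf_digraph_axioms H.wf_digraph_axioms compatible_def)
  then have "Digraph_Component.connected (with_proj ?H)"
    using con by (rule H.connected_spanning_imp_connected)
  then have "?H \<in> graph_class n (n - 4)"
    using H n V S(2) independence_number_complete_split_graph[OF fin dis \<open>S \<noteq> {}\<close>]
    by (simp add: graph_class_def)
  \<comment> \<open>A proper inclusion would give \<open>?H\<close> a larger spectral radius within
    the class, against the maximality of \<open>G\<close>; hence \<open>G\<close> equals
    \<open>?H\<close>.\<close>
  then have "\<not> parcs G \<subset> parcs ?H"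
    using A_alpha_spectral_radius_strict_mono[OF G con H V _ assms(2,3)] assms(5) by fastforce
  then have "G = ?H" using V E by (intro pair_pre_digraph.equality) auto
  then show ?thesis
    using digraph_iso_complete_split_graph_join[OF fin dis] S(2) T by simp
qed

end
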